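(* Let $\rho_-,\rho_+:[0,\infty)\to(0,1)$ be Lipschitz continuous and let $\alpha>0$. For each $N$ let $(\eta_t)_{t\ge0}$ be the time-inhomogeneous Markov process on $\{0,1\}^{\Lambda_N}$, $\Lambda_N=\{-N,\dots,N\}$, with generator $L_{N,t}=N^{2+\alpha}[L_{\mathrm{exc}}+L_{b,t}]$ at time $t$ (defined in the context). Then for every $t>0$, for any choice of initial configurations $\eta_0=\eta_0^N\in\{0,1\}^{\Lambda_N}$, for every $r\in[-1,1]$ and every local function $\varphi$ (such that $\theta_{[Nr]}\varphi$ is well defined as a function on $\{0,1\}^{\Lambda_N}$ for all large $N$, which is automatic if $|r|<1$), $$\lim_{N\to\infty}\mathbb E_{\eta_0}\big(\theta_{[Nr]}\varphi(\eta_t)\big)=\langle\varphi\rangle_{\bar\rho(r,t)},$$ where $$\bar\rho(r,t)=\tfrac12[\rho_+(t)-\rho_-(t)]\,r+\tfrac12[\rho_+(t)+\rho_-(t)],\qquad r\in[-1,1].$$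
   Context: For $f:\{0,1\}^{\Lambda_N}\to\mathbb R$, $$L_{\mathrm{exc}}f(\eta)=\frac12\sum_{x=-N}^{N-1}\big(f(\eta^{(x,x+1)})-f(\eta)\big),$$ where $\eta^{(x,y)}$ is obtained from $\eta$ by exchanging the occupation numbers at $x$ and $y$, and $$L_{b,t}f(\eta)=\sum_{\sigma=\pm}\rho_\sigma(t)^{1-\eta(\sigma N)}(1-\rho_\sigma(t))^{\eta(\sigma N)}\,[f(\eta^{\sigma N})-f(\eta)],$$ where $\eta^{x}(x)=1-\eta(x)$ and $\eta^x(y)=\eta(y)$ for $y\ne x$. $\mathbb E_{\eta_0}$ is expectation for the process started from $\eta_0$. A local function is a function on $\{0,1\}^{\mathbb Z}$ depending on finitely many occupation numbers; $\theta_x$ is the shift by $x$ (so if $\varphi$ depends on $\eta(z)$, $z\in A$, then $\theta_x\varphi$ is the same function of $\eta(z+x)$, $z\in A$). $[\cdot]$ is the integer part. $\langle\cdot\rangle_\rho$ is expectation with respect to the product Bernoulli measure with density $\rho$. *)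

theory Defs
  imports "HOL-Probability.Probability"
begin

section \<open>Time-inhomogeneous Markov processes on a finite state space\<close>

text \<open>A Markov process on \<open>S\<close> is described by transition kernels \<open>K s t x\<close>, the law at
  time \<open>t\<close> given the state \<open>x\<close> at time \<open>s\<close>.\<close>

definition transition_family :: "'s set \<Rightarrow> (real \<Rightarrow> real \<Rightarrow> 's \<Rightarrow> 's pmf) \<Rightarrow> bool" where
  "transition_family S K \<longleftrightarrow>
     (\<forall>s t x. 0 \<le> s \<and> s \<le> t \<and> x \<in> S \<longrightarrow> set_pmf (K s t x) \<subseteq> S) \<and>
     (\<forall>s x. 0 \<le> s \<and> x \<in> S \<longrightarrow> K s s x = return_pmf x) \<and>
     (\<forall>s t u x. 0 \<le> s \<and> s \<le> t \<and> t \<le> u \<and> x \<in> S \<longrightarrow>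
        K s u x = bind_pmf (K s t x) (K t u))"

text \<open>The generator at time \<open>t\<close> is the infinitesimal rate of change of the kernels at \<open>t\<close>. Both
  one-sided limits are required: the limit over \<open>[t, t + h]\<close> alone would not exclude an additional
  jump at a deterministic time.\<close>

definition has_generator ::
    "'s set \<Rightarrow> (real \<Rightarrow> real \<Rightarrow> 's \<Rightarrow> 's pmf) \<Rightarrow> (real \<Rightarrow> ('s \<Rightarrow> real) \<Rightarrow> 's \<Rightarrow> real) \<Rightarrow> bool" where
  "has_generator S K L \<longleftrightarrow>
     (\<forall>f t x. 0 \<le> t \<and> x \<in> S \<longrightarrow>
        ((\<lambda>h. (measure_pmf.expectation (K t (t + h) x) f - f x) / h) \<longlongrightarrow> L t f x) (at_right 0)) \<and>
     (\<forall>f t x. 0 < t \<and> x \<in> S \<longrightarrow>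
        ((\<lambda>h. (measure_pmf.expectation (K (t - h) t x) f - f x) / h) \<longlongrightarrow> L t f x) (at_right 0))"

definition past :: "'w measure \<Rightarrow> 's set \<Rightarrow> (real \<Rightarrow> 'w \<Rightarrow> 's) \<Rightarrow> real \<Rightarrow> 'w measure" where
  "past M S X s =
     sigma (space M) (\<Union>u\<in>{0..s}. sets (vimage_algebra (space M) (X u) (count_space S)))"

definition markov_process ::
    "'w measure \<Rightarrow> 's set \<Rightarrow> (real \<Rightarrow> real \<Rightarrow> 's \<Rightarrow> 's pmf) \<Rightarrow> 's \<Rightarrow> (real \<Rightarrow> 'w \<Rightarrow> 's) \<Rightarrow> bool" where
  "markov_process M S K x0 X \<longleftrightarrow>
     prob_space M \<and>
     (\<forall>t\<ge>0. X t \<in> M \<rightarrow>\<^sub>M count_space S) \<and>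
     (AE w in M. X 0 w = x0) \<and>
     (\<forall>s t f. 0 \<le> s \<and> s \<le> t \<longrightarrow>
        (AE w in M. real_cond_exp M (past M S X s) (\<lambda>w. f (X t w)) w =
                    measure_pmf.expectation (K s t (X s w)) f))"

definition markov_process_with_generator ::
    "'w measure \<Rightarrow> 's set \<Rightarrow> (real \<Rightarrow> ('s \<Rightarrow> real) \<Rightarrow> 's \<Rightarrow> real) \<Rightarrow> 's \<Rightarrow> (real \<Rightarrow> 'w \<Rightarrow> 's) \<Rightarrow> bool" where
  "markov_process_with_generator M S L x0 X \<longleftrightarrow>
     (\<exists>K. transition_family S K \<and> has_generator S K L \<and> markov_process M S K x0 X)"


section \<open>The exclusion process with boundary reservoirs\<close>

text \<open>\<open>True\<close> marks an occupied site. Configurations on \<open>{-N..N}\<close> are extensional functions, so that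
  \<open>configs N\<close> has exactly \<open>2 ^ (2 * N + 1)\<close> elements; \<open>int \<Rightarrow> bool\<close> is the configuration space over
  the integers.\<close>

definition sites :: "nat \<Rightarrow> int set" where
  "sites N = {- int N..int N}"

definition configs :: "nat \<Rightarrow> (int \<Rightarrow> bool) set" where
  "configs N = sites N \<rightarrow>\<^sub>E UNIV"

definition exchange :: "int \<Rightarrow> int \<Rightarrow> (int \<Rightarrow> bool) \<Rightarrow> (int \<Rightarrow> bool)" where
  "exchange x y \<eta> = \<eta>(x := \<eta> y, y := \<eta> x)"

definition flip :: "int \<Rightarrow> (int \<Rightarrow> bool) \<Rightarrow> (int \<Rightarrow> bool)" where
  "flip x \<eta> = \<eta>(x := \<not> \<eta> x)"

definition L_exc :: "nat \<Rightarrow> ((int \<Rightarrow> bool) \<Rightarrow> real) \<Rightarrow> (int \<Rightarrow> bool) \<Rightarrow> real" where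
  "L_exc N f \<eta> = 1 / 2 * (\<Sum>x = - int N..int N - 1. f (exchange x (x + 1) \<eta>) - f \<eta>)"

definition flip_rate :: "real \<Rightarrow> bool \<Rightarrow> real" where
  "flip_rate \<rho> b = \<rho> ^ (1 - of_bool b) * (1 - \<rho>) ^ of_bool b"

definition L_bdry ::
    "(real \<Rightarrow> real) \<Rightarrow> (real \<Rightarrow> real) \<Rightarrow> nat \<Rightarrow> real \<Rightarrow> ((int \<Rightarrow> bool) \<Rightarrow> real) \<Rightarrow> (int \<Rightarrow> bool) \<Rightarrow> real" where
  "L_bdry \<rho>m \<rho>p N t f \<eta> =
     flip_rate (\<rho>p t) (\<eta> (int N)) * (f (flip (int N) \<eta>) - f \<eta>) +
     flip_rate (\<rho>m t) (\<eta> (- int N)) * (f (flip (- int N) \<eta>) - f \<eta>)"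

definition L_full ::
    "real \<Rightarrow> (real \<Rightarrow> real) \<Rightarrow> (real \<Rightarrow> real) \<Rightarrow> nat \<Rightarrow> real \<Rightarrow> ((int \<Rightarrow> bool) \<Rightarrow> real) \<Rightarrow> (int \<Rightarrow> bool) \<Rightarrow> real" where
  "L_full \<alpha> \<rho>m \<rho>p N t f \<eta> = real N powr (2 + \<alpha>) * (L_exc N f \<eta> + L_bdry \<rho>m \<rho>p N t f \<eta>)"

definition depends_only_on :: "((int \<Rightarrow> bool) \<Rightarrow> real) \<Rightarrow> int set \<Rightarrow> bool" where
  "depends_only_on \<phi> A \<longleftrightarrow> (\<forall>\<eta> \<xi>. (\<forall>z\<in>A. \<eta> z = \<xi> z) \<longrightarrow> \<phi> \<eta> = \<phi> \<xi>)"

definition shift :: "int \<Rightarrow> ((int \<Rightarrow> bool) \<Rightarrow> real) \<Rightarrow> (int \<Rightarrow> bool) \<Rightarrow> real" where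
  "shift x \<phi> \<eta> = \<phi> (\<lambda>z. \<eta> (z + x))"

text \<open>If \<open>\<phi>\<close> depends only on the sites in \<open>A\<close>, then \<open>shift x \<phi>\<close> is a function on \<open>configs N\<close>
  as soon as the translate of \<open>A\<close> by \<open>x\<close> lies in \<open>sites N\<close>.\<close>

definition shift_well_defined :: "int set \<Rightarrow> int \<Rightarrow> nat \<Rightarrow> bool" where
  "shift_well_defined A x N \<longleftrightarrow> (\<lambda>z. z + x) ` A \<subseteq> sites N"

definition bernoulli_expectation :: "real \<Rightarrow> ((int \<Rightarrow> bool) \<Rightarrow> real) \<Rightarrow> real" where
  "bernoulli_expectation \<rho> \<phi> =
     integral\<^sup>L (PiM UNIV (\<lambda>_. measure_pmf (bernoulli_pmf \<rho>))) \<phi>"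

definition rho_bar :: "(real \<Rightarrow> real) \<Rightarrow> (real \<Rightarrow> real) \<Rightarrow> real \<Rightarrow> real \<Rightarrow> real" where
  "rho_bar \<rho>m \<rho>p r t = 1 / 2 * (\<rho>p t - \<rho>m t) * r + 1 / 2 * (\<rho>p t + \<rho>m t)"

end

theory Submission
  imports Defs "HOL-Combinatorics.Transposition" "HOL-Real_Asymp.Real_Asymp"
begin

text \<open>Writing \<open>u B t\<close> for the probability that all sites of \<open>B\<close> are occupied at time \<open>t\<close>, duality
  makes \<open>u\<close> solve the closed linear system \<open>u' = N\<^sup>2\<^sup>+\<^sup>\<alpha> G u\<close>, where \<open>G\<close> is the generator of exclusion
  particles absorbed at the boundary, an absorbed particle leaving the density of its reservoir as a
  factor. The product \<open>v B t\<close> of the discrete linear profile over \<open>B\<close>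
  satisfies \<open>\<bar>G v\<bar> \<le> N\<^sup>-\<^sup>2 #{adjacent pairs in B}\<close>, because only neighbouring particles feel the
  exclusion. The difference \<open>u - v\<close> is controlled by the maximum principle with a barrier made of two
  functions: the sum over \<open>x \<in> B\<close> of \<open>3 N\<^sup>2 - x\<^sup>2\<close>, on which \<open>G\<close> is at most \<open>-card B\<close>, absorbs the initial
  condition (with weight \<open>exp (-N\<^sup>\<alpha> t / 3) / N\<^sup>2\<close>) and the Lipschitz time dependence of \<open>v\<close>
  (with weight \<open>N\<^sup>-\<^sup>2\<^sup>-\<^sup>\<alpha>\<close>); the sum over pairs in \<open>B\<close> of \<open>2 N + 1 - \<bar>x - y\<bar>\<close>, on which \<open>G\<close> is at most minus
  the number of adjacent pairs, absorbs the exclusion error (with weight \<open>N\<^sup>-\<^sup>2\<close>). The barrier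
  vanishes as \<open>N\<close> grows with \<open>card B\<close> fixed, and every local function is a linear combination of the
  indicators that a set of sites is occupied.\<close>

section \<open>Forward equation on a finite state space\<close>

lemma kernel_expectation:
  assumes "transition_family S K" "finite S" "x0 \<in> S" "0 \<le> s" "s \<le> t"
  shows "measure_pmf.expectation (K 0 t x0) f =
    (\<Sum>x\<in>S. pmf (K 0 s x0) x * measure_pmf.expectation (K s t x) f)"
proof -
  have "K 0 t x0 = bind_pmf (K 0 s x0) (K s t)"
    using assms unfolding transition_family_def by auto
  moreover have "set_pmf (K 0 s x0) \<subseteq> S" "\<And>x. x \<in> S \<Longrightarrow> set_pmf (K s t x) \<subseteq> S"
    using assms unfolding transition_family_def by auto
  ultimately show ?thesis
    using pmf_expectation_bind[of S "K s t" "K 0 s x0" f] assms(2) finite_subset by fastforce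
qed

lemma expectation_finite_support:
  fixes f :: "'s \<Rightarrow> real"
  assumes "finite S" "set_pmf p \<subseteq> S"
  shows "measure_pmf.expectation p f = (\<Sum>x\<in>S. pmf p x * f x)"
  using integral_measure_pmf_real[of S p f] assms by (auto simp: mult.commute)

lemma kernel_increment:
  assumes "transition_family S K" "finite S" "x0 \<in> S" "0 \<le> s" "s \<le> t"
  shows "measure_pmf.expectation (K 0 t x0) f - measure_pmf.expectation (K 0 s x0) f =
    (\<Sum>x\<in>S. pmf (K 0 s x0) x * (measure_pmf.expectation (K s t x) f - f x))"
proof -
  have "set_pmf (K 0 s x0) \<subseteq> S"
    using assms unfolding transition_family_def by auto
  then show ?thesis
    unfolding kernel_expectation[OF assms]
    by (simp add: expectation_finite_support[OF assms(2)] sum_subtractf right_diff_distrib)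
qed

text \<open>Conditioning on the state at time \<open>t\<close> confines the increment over
  \<open>[t, s]\<close> to the second kernel, so the forward limit in \<open>has_generator\<close>
  can be summed over the finite state space. A one-sided derivative is all that the comparison
  argument asks for.\<close>

lemma forward_equation:
  assumes "transition_family S K" "has_generator S K L" "finite S" "x0 \<in> S" "0 \<le> t"
  shows "((\<lambda>s. measure_pmf.expectation (K 0 s x0) f) has_real_derivative
    measure_pmf.expectation (K 0 t x0) (L t f)) (at_right t)"
proof -
  have S: "set_pmf (K 0 t x0) \<subseteq> S"
    using assms unfolding transition_family_def by auto
  have "((\<lambda>h. \<Sum>x\<in>S. pmf (K 0 t x0) x * ((measure_pmf.expectation (K t (t + h) x) f - f x) / h))
     \<longlongrightarrow> (\<Sum>x\<in>S. pmf (K 0 t x0) x * L t f x)) (at_right 0)"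
    using assms(2,5) unfolding has_generator_def by (intro tendsto_intros) auto
  then have "((\<lambda>s. \<Sum>x\<in>S. pmf (K 0 t x0) x * ((measure_pmf.expectation (K t s x) f - f x) / (s - t)))
     \<longlongrightarrow> (\<Sum>x\<in>S. pmf (K 0 t x0) x * L t f x)) (at_right t)"
    by (subst filterlim_at_right_to_0) (simp add: add.commute)
  moreover have "\<forall>\<^sub>F s in at_right t.
     (\<Sum>x\<in>S. pmf (K 0 t x0) x * ((measure_pmf.expectation (K t s x) f - f x) / (s - t))) =
     (measure_pmf.expectation (K 0 s x0) f - measure_pmf.expectation (K 0 t x0) f) / (s - t)"
    using eventually_at_right_less[of t]
    by eventually_elim
      (simp add: kernel_increment[OF assms(1,3,4,5)] sum_divide_distrib)
  ultimately have "((\<lambda>s. (measure_pmf.expectation (K 0 s x0) f - measure_pmf.expectation (K 0 t x0) f)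
      / (s - t)) \<longlongrightarrow> (\<Sum>x\<in>S. pmf (K 0 t x0) x * L t f x)) (at_right t)"
    by (rule Lim_transform_eventually)
  then show ?thesis
    by (simp add: has_field_derivative_iff expectation_finite_support[OF assms(3) S])
qed

text \<open>Right continuity comes with the right derivative. Left continuity rests on the backward
  limit in \<open>has_generator\<close>: a jump at a deterministic time would defeat the comparison
  argument.\<close>

lemma continuous_on_expectation:
  fixes f :: "'s \<Rightarrow> real"
  assumes "transition_family S K" "has_generator S K L" "finite S" "x0 \<in> S"
  shows "continuous_on {0..} (\<lambda>s. measure_pmf.expectation (K 0 s x0) f)"
proof -
  let ?u = "\<lambda>s. measure_pmf.expectation (K 0 s x0) f"
  have right: "(?u \<longlongrightarrow> ?u t) (at_right t)" if "0 \<le> t" for t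
    using forward_equation[OF assms that, of f, THEN DERIV_continuous]
    by (simp add: continuous_within)
  have left: "(?u \<longlongrightarrow> ?u t) (at_left t)" if "0 < t" for t
  proof -
    have null: "((\<lambda>h. \<Sum>x\<in>S. \<bar>measure_pmf.expectation (K (t - h) t x) f - f x\<bar>) \<longlongrightarrow> (\<Sum>x\<in>S. 0)) (at_right 0)"
    proof (intro tendsto_sum tendsto_rabs_zero)
      fix x assume "x \<in> S"
      then have "((\<lambda>h. (measure_pmf.expectation (K (t - h) t x) f - f x) / h) \<longlongrightarrow> L t f x) (at_right 0)"
        using assms(2) that unfolding has_generator_def by auto
      then have "((\<lambda>h. (measure_pmf.expectation (K (t - h) t x) f - f x) / h * h) \<longlongrightarrow> L t f x * 0) (at_right 0)"
        by (intro tendsto_mult tendsto_ident_at)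
      moreover have "\<forall>\<^sub>F h in at_right 0. (measure_pmf.expectation (K (t - h) t x) f - f x) / h * h =
         measure_pmf.expectation (K (t - h) t x) f - f x"
        using eventually_at_right_less[of "0::real"] by eventually_elim simp
      ultimately show "((\<lambda>h. measure_pmf.expectation (K (t - h) t x) f - f x) \<longlongrightarrow> 0) (at_right 0)"
        unfolding mult_zero_right
        by (rule Lim_transform_eventually)
    qed
    \<comment> \<open>The weights \<open>pmf (K 0 (t - h) x0) x\<close> move with \<open>h\<close>,
      but they lie in \<open>[0, 1]\<close>, so they are bounded away instead of being passed to a
      limit.\<close>
    have "\<forall>\<^sub>F h in at_right 0. norm (?u (t - h) - ?u t) \<le>
       (\<Sum>x\<in>S. \<bar>measure_pmf.expectation (K (t - h) t x) f - f x\<bar>)"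
      using eventually_at_right_less[of "0::real"] eventually_at_right_real[OF that]
    proof eventually_elim
      case (elim h)
      then have "?u t - ?u (t - h) = (\<Sum>x\<in>S. pmf (K 0 (t - h) x0) x * (measure_pmf.expectation (K (t - h) t x) f - f x))"
        by (intro kernel_increment assms) auto
      moreover have "\<bar>\<dots>\<bar> \<le> (\<Sum>x\<in>S. \<bar>measure_pmf.expectation (K (t - h) t x) f - f x\<bar>)"
        by (rule order_trans[OF sum_abs], intro sum_mono)
          (simp add: abs_mult mult_left_le_one_le pmf_le_1)
      ultimately show ?case by (simp add: abs_minus_commute)
    qed
    then have "((\<lambda>h. ?u (t - h) - ?u t) \<longlongrightarrow> 0) (at_right 0)"
      by (rule Lim_null_comparison) (use null in simp)
    then have "((\<lambda>h. ?u (t - h)) \<longlongrightarrow> ?u t) (at_right 0)"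
      using Lim_null by blast
    then show ?thesis
      by (simp add: filterlim_at_left_to_right[of _ _ t] filterlim_at_right_to_0[of _ _ "-t"])
  qed
  show ?thesis
    unfolding continuous_on_def
  proof
    fix t :: real assume t: "t \<in> {0..}"
    show "(?u \<longlongrightarrow> ?u t) (at t within {0..})"
    proof (cases "t = 0")
      case True
      then show ?thesis using right[of 0] by (simp add: at_within_Ici_at_right)
    next
      case False
      then have "(?u \<longlongrightarrow> ?u t) (at t)"
        using left right t by (intro filterlim_split_at) auto
      then show ?thesis
        using tendsto_within_subset by blast
    qed
  qed
qed

section \<open>From the process to its transition kernels\<close>

text \<open>The Markov property is applied at time 0 only. There the state is almost surely
  \<open>x0\<close>, so the conditional expectation is a constant, and integrating it gives the
  claim.\<close>

lemma markov_process_expectation: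
  fixes f :: "'s \<Rightarrow> real"
  assumes mp: "markov_process M S K x0 X" and S: "finite S" and t: "0 \<le> t"
  shows "prob_space.expectation M (\<lambda>w. f (X t w)) = measure_pmf.expectation (K 0 t x0) f"
proof -
  interpret prob_space M using mp unfolding markov_process_def by simp
  have X: "X s \<in> M \<rightarrow>\<^sub>M count_space S" if "s \<ge> 0" for s
    using mp that unfolding markov_process_def by simp
  have sub: "subalgebra M (past M S X 0)"
  proof -
    have "(\<Union>u\<in>{0..0}. sets (vimage_algebra (space M) (X u) (count_space S))) \<subseteq> sets M"
      using sets_image_in_sets[OF refl X[of 0]] by simp
    then show ?thesis
      unfolding past_def subalgebra_def
      by (auto simp: sets_measure_of_conv sets.sigma_sets_subset space_measure_of_conv)
  qed
  interpret finite_measure_subalgebra M "past M S X 0"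
    by standard (rule sub)
  have m: "(\<lambda>w. f (X t w)) \<in> borel_measurable M"
    using measurable_compose[OF X[OF t], of f borel] by simp
  have int: "integrable M (\<lambda>w. f (X t w))"
  proof (rule integrable_const_bound[of _ "Max ((\<lambda>x. \<bar>f x\<bar>) ` S)"])
    show "AE w in M. norm (f (X t w)) \<le> Max ((\<lambda>x. \<bar>f x\<bar>) ` S)"
      using measurable_space[OF X[OF t]] S by (intro AE_I2) (auto intro!: Max_ge)
  qed (rule m)
  have "AE w in M. real_cond_exp M (past M S X 0) (\<lambda>w. f (X t w)) w =
          measure_pmf.expectation (K 0 t (X 0 w)) f" "AE w in M. X 0 w = x0"
    using mp t unfolding markov_process_def by auto
  then have "AE w in M. real_cond_exp M (past M S X 0) (\<lambda>w. f (X t w)) w =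
          measure_pmf.expectation (K 0 t x0) f"
    by eventually_elim simp
  then have "(\<integral>w. real_cond_exp M (past M S X 0) (\<lambda>w. f (X t w)) w \<partial>M) =
     (\<integral>w. measure_pmf.expectation (K 0 t x0) f \<partial>M)"
    by (intro integral_cong_AE) auto
  then show ?thesis
    using real_cond_exp_int(2)[OF int] by (simp add: prob_space)
qed

section \<open>A maximum principle\<close>

text \<open>First-crossing argument at the infimum \<open>s\<close> of the times at which some
  component is positive. By continuity no component is positive at \<open>s\<close>; negative ones
  stay negative for a while, those equal to zero are handled by \<open>step\<close>, and finiteness
  of \<open>I\<close> gives a common right neighbourhood, contradicting the choice of
  \<open>s\<close>.\<close>

lemma comparison_principle:
  fixes w :: "'i \<Rightarrow> real \<Rightarrow> real"
  assumes "finite I"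
    and cont: "\<And>i. i \<in> I \<Longrightarrow> continuous_on {0..} (w i)"
    and init: "\<And>i. i \<in> I \<Longrightarrow> w i 0 \<le> 0"
    and step: "\<And>i s. i \<in> I \<Longrightarrow> 0 \<le> s \<Longrightarrow> w i s = 0 \<Longrightarrow> (\<And>j. j \<in> I \<Longrightarrow> w j s \<le> 0)
       \<Longrightarrow> \<forall>\<^sub>F s' in at_right s. w i s' \<le> 0"
    and "i \<in> I" "0 \<le> t"
  shows "w i t \<le> 0"
proof (rule ccontr)
  define Z where "Z = {s. 0 \<le> s \<and> (\<exists>i\<in>I. w i s > 0)}"
  assume "\<not> w i t \<le> 0"
  then have "t \<in> Z" using \<open>i \<in> I\<close> \<open>0 \<le> t\<close> by (auto simp: Z_def not_le)
  have bdd: "bdd_below Z" by (auto simp: Z_def bdd_below_def)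
  define s where "s = Inf Z"
  have s0: "s \<ge> 0" unfolding s_def using \<open>t \<in> Z\<close> by (intro cInf_greatest) (auto simp: Z_def)
  have before: "w j r \<le> 0" if "j \<in> I" "0 \<le> r" "r < s" for j r
    using that cInf_lower[OF _ bdd, of r] by (force simp: Z_def s_def)
  have at: "w j s \<le> 0" if j: "j \<in> I" for j
  proof (cases "s = 0")
    case False
    then have "s > 0" using s0 by simp
    have "(w j \<longlongrightarrow> w j s) (at s within {0..})"
      using cont[OF j] s0 by (simp add: continuous_on_def)
    moreover have "at s within {0..} = at s"
      using \<open>s > 0\<close> by (intro at_within_interior) auto
    ultimately have "(w j \<longlongrightarrow> w j s) (at_left s)"
      by (simp add: filterlim_at_split)
    moreover have "\<forall>\<^sub>F r in at_left s. w j r \<le> 0"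
      using eventually_at_left_real[OF \<open>s > 0\<close>] by eventually_elim (use before j in auto)
    ultimately show ?thesis by (intro tendsto_upperbound[of "w j" "w j s" "at_left s"]) auto
  qed (use init j in simp)
  have after: "\<forall>\<^sub>F r in at_right s. w j r \<le> 0" if j: "j \<in> I" for j
  proof (cases "w j s = 0")
    case True then show ?thesis using step[OF j s0] at by simp
  next
    case False
    then have neg: "w j s < 0" using at[OF j] by simp
    have "(w j \<longlongrightarrow> w j s) (at s within {0..})"
      using cont[OF j] s0 by (simp add: continuous_on_def)
    then have "(w j \<longlongrightarrow> w j s) (at_right s)"
      by (rule tendsto_within_subset) (use s0 in auto)
    from order_tendstoD(2)[OF this neg] show ?thesis
      by eventually_elim simp
  qed
  then have "\<forall>\<^sub>F r in at_right s. \<forall>j\<in>I. w j r \<le> 0"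
    using assms(1) by (simp add: eventually_ball_finite)
  then obtain b where b: "b > s" "\<And>r j. s < r \<Longrightarrow> r < b \<Longrightarrow> j \<in> I \<Longrightarrow> w j r \<le> 0"
    by (auto simp: eventually_at_right_field)
  have "b \<le> r" if "r \<in> Z" for r
  proof (rule ccontr)
    assume "\<not> b \<le> r"
    moreover have "s \<le> r" unfolding s_def by (rule cInf_lower[OF that bdd])
    ultimately show False using b(2)[of r] at that by (cases "r = s") (force simp: Z_def)+
  qed
  then have "b \<le> s" unfolding s_def using \<open>t \<in> Z\<close> by (intro cInf_greatest) auto
  then show False using b by simp
qed

section \<open>Duality\<close>

definition occupied :: "int set \<Rightarrow> (int \<Rightarrow> bool) \<Rightarrow> real" where
  "occupied B \<eta> = (\<Prod>x\<in>B. of_bool (\<eta> x))"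

text \<open>Stirring form of exclusion: a bond with both ends in \<open>B\<close> leaves the set
  unchanged, so the exclusion rule needs no case distinction in the generator.\<close>

abbreviation swap :: "int \<Rightarrow> int set \<Rightarrow> int set" where
  "swap x B \<equiv> Transposition.transpose x (x + 1) ` B"

text \<open>The dual particles are killed at the two end sites at rate 1, and each killing multiplies by the
  density of the reservoir.\<close>

definition dual_gen :: "nat \<Rightarrow> real \<Rightarrow> real \<Rightarrow> (int set \<Rightarrow> real) \<Rightarrow> int set \<Rightarrow> real" where
  "dual_gen N a b D B =
     1 / 2 * (\<Sum>x = - int N..int N - 1. D (swap x B) - D B) +
     of_bool (int N \<in> B) * (b * D (B - {int N}) - D B) +
     of_bool (- int N \<in> B) * (a * D (B - {- int N}) - D B)"

lemma swap_subset_sites: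
  assumes "B \<subseteq> sites N" "x \<in> {- int N..int N - 1}"
  shows "swap x B \<subseteq> sites N"
  using assms by (auto simp: sites_def Transposition.transpose_def)

text \<open>The values of \<open>D\<close> at sets other than \<open>B\<close> enter with
  nonnegative coefficients; only the value at \<open>B\<close> itself enters negatively, and there
  the two functions agree. This is the positivity behind the maximum principle.\<close>

lemma dual_gen_mono:
  assumes "\<And>C. C \<subseteq> sites N \<Longrightarrow> D C \<le> D' C" "D B = D' B" "B \<subseteq> sites N" "0 \<le> a" "0 \<le> b"
  shows "dual_gen N a b D B \<le> dual_gen N a b D' B"
  unfolding dual_gen_def using assms swap_subset_sites[OF assms(3)]
  by (intro add_mono mult_left_mono sum_mono diff_mono assms(1)) auto

lemma dual_gen_linear:
  "dual_gen N a b (\<lambda>C. c * D C + D' C) B = c * dual_gen N a b D B + dual_gen N a b D' B"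
  unfolding dual_gen_def
  by (simp add: sum.distrib sum_subtractf sum_distrib_left algebra_simps)

lemma occupied_exchange: "occupied B (exchange x (x + 1) \<eta>) = occupied (swap x B) \<eta>"
proof -
  have "exchange x (x + 1) \<eta> = \<eta> \<circ> Transposition.transpose x (x + 1)"
    by (rule ext) (auto simp: exchange_def Transposition.transpose_def)
  then show ?thesis
    by (simp add: occupied_def prod.reindex)
qed

text \<open>For \<open>x\<close> in \<open>B\<close>, an occupied site is emptied at rate
  \<open>1 - \<rho>\<close> and an empty one filled at rate \<open>\<rho>\<close>. Since these rates
  add up to 1, both cases are given by one expression linear in \<open>occupied\<close>: killing at
  rate 1 with factor \<open>\<rho>\<close>.\<close>

lemma occupied_flip:
  assumes "finite B"
  shows "flip_rate \<rho> (\<eta> x) * (occupied B (flip x \<eta>) - occupied B \<eta>) =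
     of_bool (x \<in> B) * (\<rho> * occupied (B - {x}) \<eta> - occupied B \<eta>)"
proof (cases "x \<in> B")
  case True
  have *: "(\<Prod>y\<in>B. of_bool (\<xi> y)) = of_bool (\<xi> x) * (\<Prod>y\<in>B - {x}. of_bool (\<xi> y) :: real)" for \<xi>
    using prod.remove[OF assms True] by blast
  show ?thesis
    unfolding occupied_def *[of "flip x \<eta>"] *[of \<eta>] using True
    by (auto simp: flip_def flip_rate_def algebra_simps)
next
  case False
  then have "occupied B (flip x \<eta>) = occupied B \<eta>"
    unfolding occupied_def by (intro prod.cong) (auto simp: flip_def)
  then show ?thesis using False by simp
qed

text \<open>Duality: the action on the configuration becomes an action on the set \<open>B\<close>,
  and no larger set appears, so taking expectations gives a closed finite linear system.\<close>

lemma L_full_occupied: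
  assumes "finite B"
  shows "L_full \<alpha> \<rho>m \<rho>p N t (occupied B) \<eta> =
    real N powr (2 + \<alpha>) * dual_gen N (\<rho>m t) (\<rho>p t) (\<lambda>C. occupied C \<eta>) B"
  unfolding L_full_def L_exc_def L_bdry_def dual_gen_def
  by (simp only: occupied_exchange occupied_flip[OF assms] add.assoc)

lemma sum_telescope_int:
  fixes F :: "int \<Rightarrow> real"
  assumes "a \<le> b"
  shows "(\<Sum>x = a..b - 1. F x - F (x + 1)) = F a - F b"
  using assms
proof (induction b rule: int_ge_induct)
  case (step i)
  have "{a..i + 1 - 1} = insert i {a..i - 1}" using step.hyps by auto
  then show ?case using step by simp
qed simp

lemma swap_cases:
  obtains (right) "x \<in> B" "x + 1 \<notin> B" "swap x B = insert (x + 1) (B - {x})"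
  | (left) "x \<notin> B" "x + 1 \<in> B" "swap x B = insert x (B - {x + 1})"
  | (id) "x \<in> B \<longleftrightarrow> x + 1 \<in> B" "swap x B = B"
proof -
  consider "x \<in> B" "x + 1 \<notin> B" | "x \<notin> B" "x + 1 \<in> B" | "x \<in> B \<longleftrightarrow> x + 1 \<in> B" by blast
  then show thesis
  proof cases
    case 1
    have "swap x B = insert (x + 1) (B - {x})"
      using 1 by (auto simp: image_iff Transposition.transpose_def)
    then show ?thesis using right 1 by blast
  next
    case 2
    have "swap x B = insert x (B - {x + 1})"
      using 2 by (auto simp: image_iff Transposition.transpose_def)
    then show ?thesis using left 2 by blast
  next
    case 3
    then have "swap x B = B" by (cases "x \<in> B") auto
    then show ?thesis using id 3 by blast
  qed
qed

section \<open>The linear profile and the two supersolutions\<close>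

definition adjacent_pairs :: "nat \<Rightarrow> int set \<Rightarrow> real" where
  "adjacent_pairs N B = (\<Sum>x = - int N..int N - 1. of_bool (x \<in> B \<and> x + 1 \<in> B))"

text \<open>The densities \<open>a\<close> and \<open>b\<close> are attained at the half-integers \<open>-N - 1/2\<close> and \<open>N + 1/2\<close>, which makes the
  boundary terms of \<open>dual_gen\<close> cancel the end terms of the telescoping sum over bonds.\<close>

definition profile :: "nat \<Rightarrow> real \<Rightarrow> real \<Rightarrow> int \<Rightarrow> real" where
  "profile N a b x = (a + b) / 2 + (b - a) * x / (2 * N + 1)"

lemma profile_in_unit:
  assumes "a \<in> {0..1}" "b \<in> {0..1}" "x \<in> sites N"
  shows "profile N a b x \<in> {0..1}"
proof -
  \<comment> \<open>Position of \<open>x\<close> after mapping the interval from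
    \<open>-N - 1/2\<close> to \<open>N + 1/2\<close> affinely onto \<open>[0, 1]\<close>.\<close>
  define \<theta> where "\<theta> = 1 / 2 + x / (2 * N + 1)"
  have \<theta>: "0 \<le> \<theta>" "\<theta> \<le> 1" using assms(3) by (auto simp: \<theta>_def sites_def field_simps)
  have "profile N a b x = (1 - \<theta>) * a + \<theta> * b"
    by (simp add: profile_def \<theta>_def algebra_simps add_divide_distrib diff_divide_distrib)
  moreover have "(1 - \<theta>) * a + \<theta> * b \<le> (1 - \<theta>) * 1 + \<theta> * 1"
    using \<theta> assms by (intro add_mono mult_left_mono) auto
  moreover have "0 \<le> (1 - \<theta>) * a + \<theta> * b" using \<theta> assms by simp
  ultimately show ?thesis by simp
qed

lemma profile_lipschitz:
  assumes "\<bar>a - a'\<bar> \<le> d" "\<bar>b - b'\<bar> \<le> d" "x \<in> sites N"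
  shows "\<bar>profile N a b x - profile N a' b' x\<bar> \<le> d"
proof -
  define \<theta> where "\<theta> = 1 / 2 + x / (2 * N + 1)"
  have \<theta>: "0 \<le> \<theta>" "\<theta> \<le> 1" using assms(3) by (auto simp: \<theta>_def sites_def field_simps)
  have "profile N a b x - profile N a' b' x = (1 - \<theta>) * (a - a') + \<theta> * (b - b')"
    by (simp add: profile_def \<theta>_def algebra_simps add_divide_distrib diff_divide_distrib)
  also have "\<bar>\<dots>\<bar> \<le> (1 - \<theta>) * d + \<theta> * d"
    using \<theta> assms by (intro order_trans[OF abs_triangle_ineq] add_mono)
       (auto simp: abs_mult intro!: mult_left_mono)
  finally show ?thesis by (simp add: algebra_simps)
qed

text \<open>The generator is computed exactly: a linear profile is discrete harmonic, so the bond
  terms telescope and cancel against the killing terms. What remains is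
  \<open>- d\<^sup>2 / 2\<close> times a product in \<open>[0, 1]\<close> for each bond with both
  ends in \<open>B\<close>.\<close>

lemma dual_gen_profile:
  assumes B: "B \<subseteq> sites N" and a: "a \<in> {0..1}" and b: "b \<in> {0..1}" and N: "N > 0"
  shows "\<bar>dual_gen N a b (\<lambda>C. \<Prod>x\<in>C. profile N a b x) B\<bar> \<le> adjacent_pairs N B / (real N)\<^sup>2"
proof -
  let ?\<gamma> = "profile N a b"
  let ?v = "\<lambda>C. \<Prod>x\<in>C. ?\<gamma> x"
  have fin: "finite B" using B finite_subset by (auto simp: sites_def)
  define d where "d = (b - a) / (2 * real N + 1)"
  have \<gamma>: "?\<gamma> (x + 1) = ?\<gamma> x + d" for x
    by (simp add: profile_def d_def algebra_simps add_divide_distrib diff_divide_distrib)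
  then have \<gamma>': "?\<gamma> (1 + x) = ?\<gamma> x + d" for x by (metis add.commute)
  define F where "F x = of_bool (x \<in> B) * ?v (B - {x})" for x
  define R where "R x = of_bool (x \<in> B \<and> x + 1 \<in> B) * ?v (B - {x, x + 1})" for x
  have rem: "?v B = ?\<gamma> x * ?v (B - {x})" if "x \<in> B" for x
    using prod.remove[OF fin that] by blast
  \<comment> \<open>A move out of \<open>x\<close> contributes \<open>d * F x\<close>, one out of
    \<open>x + 1\<close> contributes \<open>- d * F (x + 1)\<close>. If both ends are occupied these
    would add up to \<open>d\<^sup>2 * R x\<close>, whereas the swap changes nothing; hence the
    correction.\<close>
  have bond: "?v (swap x B) - ?v B = (d * F x - d * F (x + 1)) - d\<^sup>2 * R x" for x
  proof (cases rule: swap_cases[where x = x and B = B])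
    case right
    then show ?thesis using fin by (simp add: F_def R_def rem \<gamma> \<gamma>' algebra_simps)
  next
    case left
    then show ?thesis using fin by (simp add: F_def R_def rem[of "x + 1"] \<gamma> \<gamma>' algebra_simps)
  next
    case id
    show ?thesis
    proof (cases "x \<in> B")
      case True
      have 1: "?v (B - {x}) = ?\<gamma> (x + 1) * ?v (B - {x, x + 1})"
        using prod.remove[of "B - {x}" "x + 1" ?\<gamma>] True id fin by (simp add: Diff_insert2[symmetric] insert_commute)
      have 2: "?v (B - {x + 1}) = ?\<gamma> x * ?v (B - {x, x + 1})"
        using prod.remove[of "B - {x + 1}" "x" ?\<gamma>] True id fin
          by (simp add: Diff_insert2[symmetric] insert_commute[of x "x + 1"])
      have F: "F x = (?\<gamma> x + d) * R x" "F (x + 1) = ?\<gamma> x * R x"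
        using True id by (simp_all add: F_def R_def 1 2 \<gamma>)
      show ?thesis unfolding id(2) F by (simp add: algebra_simps power2_eq_square)
    qed (use id in \<open>simp add: F_def R_def\<close>)
  qed
  have "(\<Sum>x = - int N..int N - 1. ?v (swap x B) - ?v B)
     = (d * F (- int N) - d * F (int N)) - d\<^sup>2 * (\<Sum>x = - int N..int N - 1. R x)"
    unfolding bond sum_subtractf[of "\<lambda>x. d * F x - d * F (x + 1)"]
    by (simp add: sum_telescope_int[of _ _ "\<lambda>x. d * F x"] sum_distrib_left)
  \<comment> \<open>Half a lattice step separates the end site from the point where the reservoir
    density is attained, which matches the factor 1/2 of the telescoped sum.\<close>
  moreover have "of_bool (int N \<in> B) * (b * ?v (B - {int N}) - ?v B) = d / 2 * F (int N)"
  proof -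
    have "b - ?\<gamma> (int N) = d / 2" by (simp add: profile_def d_def field_simps)
    then have "b * ?v (B - {int N}) - ?\<gamma> (int N) * ?v (B - {int N}) = d / 2 * ?v (B - {int N})"
      by (simp only: left_diff_distrib[symmetric])
    then show ?thesis using rem[of "int N"] by (simp add: F_def)
  qed
  moreover have "of_bool (- int N \<in> B) * (a * ?v (B - {- int N}) - ?v B) = - d / 2 * F (- int N)"
  proof -
    have "a - ?\<gamma> (- int N) = - d / 2" by (simp add: profile_def d_def field_simps)
    then have "a * ?v (B - {- int N}) - ?\<gamma> (- int N) * ?v (B - {- int N}) = - d / 2 * ?v (B - {- int N})"
      by (simp only: left_diff_distrib[symmetric])
    then show ?thesis using rem[of "- int N"] by (simp add: F_def)
  qed
  ultimately have eq: "dual_gen N a b ?v B = - d\<^sup>2 / 2 * (\<Sum>x = - int N..int N - 1. R x)"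
    unfolding dual_gen_def by (simp add: algebra_simps)
  have v: "0 \<le> ?v C" "?v C \<le> 1" if "C \<subseteq> B" for C
    using profile_in_unit[OF a b] that B by (auto intro!: prod_nonneg prod_le_1)
  have R: "0 \<le> R x" "R x \<le> of_bool (x \<in> B \<and> x + 1 \<in> B)" for x
    using v[of "B - {x, x + 1}"] by (auto simp: R_def)
  have "\<bar>d\<bar> \<le> 1 / real N"
    using a b N unfolding d_def abs_divide by (intro frac_le) auto
  then have "d\<^sup>2 \<le> (1 / real N)\<^sup>2" by (metis abs_ge_zero power2_abs power_mono)
  then have "d\<^sup>2 \<le> 1 / (real N)\<^sup>2" by (simp add: power_divide)
  moreover have "d\<^sup>2 / 2 \<le> d\<^sup>2" by simp
  ultimately have "d\<^sup>2 / 2 \<le> 1 / (real N)\<^sup>2" by linarith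
  then have "d\<^sup>2 / 2 * (\<Sum>x = - int N..int N - 1. R x) \<le> 1 / (real N)\<^sup>2 * adjacent_pairs N B"
    unfolding adjacent_pairs_def using R by (intro mult_mono sum_mono sum_nonneg) auto
  moreover have "0 \<le> d\<^sup>2 / 2 * (\<Sum>x = - int N..int N - 1. R x)"
    using R by (intro mult_nonneg_nonneg sum_nonneg) auto
  ultimately show ?thesis unfolding eq by simp
qed

section \<open>Supersolution for the initial condition and the time dependence\<close>

text \<open>The second difference of \<open>- x\<^sup>2\<close> gives a drift of -1 per particle.
  The constant \<open>3 * N\<^sup>2\<close>, rather than \<open>N\<^sup>2\<close>, keeps each
  summand at least \<open>2 * N\<^sup>2\<close>, so that a killing at an end site outweighs the
  boundary term there.\<close>

definition parabola :: "nat \<Rightarrow> int set \<Rightarrow> real" where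
  "parabola N B = (\<Sum>x\<in>B. 3 * (real N)\<^sup>2 - (real_of_int x)\<^sup>2)"

lemma site_sq_le: "x \<in> sites N \<Longrightarrow> (real_of_int x)\<^sup>2 \<le> (real N)\<^sup>2"
  by (auto simp: sites_def abs_le_square_iff[symmetric])

lemma parabola_bounds:
  assumes "B \<subseteq> sites N"
  shows "2 * (real N)\<^sup>2 * card B \<le> parabola N B" "parabola N B \<le> 3 * (real N)\<^sup>2 * card B"
proof -
  have "(\<Sum>x\<in>B. 2 * (real N)\<^sup>2) \<le> parabola N B" "parabola N B \<le> (\<Sum>x\<in>B. 3 * (real N)\<^sup>2)"
    unfolding parabola_def using assms site_sq_le by (intro sum_mono; fastforce)+
  then show "2 * (real N)\<^sup>2 * card B \<le> parabola N B" "parabola N B \<le> 3 * (real N)\<^sup>2 * card B"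
    by (simp_all add: mult_ac)
qed

text \<open>Bonds are indexed by their left ends, which miss the site \<open>N\<close>.\<close>

lemma sum_of_bool_bonds:
  assumes "B \<subseteq> sites N"
  shows "(\<Sum>x = - int N..int N - 1. of_bool (x \<in> B)) = real (card B) - of_bool (int N \<in> B)"
proof -
  have "(\<Sum>x\<in>sites N. of_bool (x \<in> B)) = real (card B)"
    using assms by (simp add: sum_of_bool_eq Int_absorb1 sites_def)
  moreover have "sites N = insert (int N) {- int N..int N - 1}" by (auto simp: sites_def)
  then have "(\<Sum>x\<in>sites N. of_bool (x \<in> B)) =
      of_bool (int N \<in> B) + (\<Sum>x = - int N..int N - 1. of_bool (x \<in> B) :: real)"
    by (simp only:) (subst sum.insert, auto)
  ultimately show ?thesis by linarith
qed

lemma dual_gen_parabola: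
  assumes B: "B \<subseteq> sites N" and N: "N > 0" and a: "a \<in> {0..1}" and b: "b \<in> {0..1}"
  shows "dual_gen N a b (parabola N) B \<le> - real (card B)"
proof -
  have fin: "finite B" using B finite_subset by (auto simp: sites_def)
  \<comment> \<open>\<open>P x\<close> is the change of the sum when a particle jumps from
    \<open>x\<close> to \<open>x - 1\<close>; the jump to \<open>x + 1\<close> changes it by
    \<open>- P x - 2\<close>.\<close>
  define P where "P x = (2 * real_of_int x - 1) * of_bool (x \<in> B)" for x
  have rem: "parabola N B = 3 * (real N)\<^sup>2 - (real_of_int x)\<^sup>2 + parabola N (B - {x})" if "x \<in> B" for x
    unfolding parabola_def using sum.remove[OF fin that] by blast
  have bond: "parabola N (swap x B) - parabola N B = - (P x - P (x + 1)) - 2 * of_bool (x \<in> B)" for x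
  proof (cases rule: swap_cases[where x = x and B = B])
    case right
    then have "parabola N (swap x B) = 3 * (real N)\<^sup>2 - (real_of_int (x + 1))\<^sup>2 + parabola N (B - {x})"
      using fin by (simp add: parabola_def)
    then show ?thesis using right by (simp add: P_def rem power2_eq_square algebra_simps)
  next
    case left
    then have "parabola N (swap x B) = 3 * (real N)\<^sup>2 - (real_of_int x)\<^sup>2 + parabola N (B - {x + 1})"
      using fin by (simp add: parabola_def)
    then show ?thesis using left by (simp add: P_def rem[of "x + 1"] power2_eq_square algebra_simps)
  next
    case id
    then show ?thesis by (simp add: P_def)
  qed
  have "(\<Sum>x = - int N..int N - 1. parabola N (swap x B) - parabola N B)
    = - (P (- int N) - P (int N)) - 2 * (real (card B) - of_bool (int N \<in> B))"
    unfolding bond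
    by (simp add: sum_subtractf[of "\<lambda>x. - (P x - P (x + 1))"] sum_negf[of "\<lambda>x. P x - P (x + 1)"] sum_telescope_int
       sum_of_bool_bonds[OF B] sum_distrib_left[symmetric] del: minus_diff_eq)
  moreover have kill: "of_bool (x \<in> B) * (c * parabola N (B - {x}) - parabola N B) \<le> - (2 * (real N)\<^sup>2) * of_bool (x \<in> B)"
    if "c \<in> {0..1}" "x \<in> sites N" for c x
  proof -
    have "0 \<le> parabola N (B - {x})"
      using parabola_bounds(1)[of "B - {x}" N] B by (intro order_trans[OF _ parabola_bounds(1)]) auto
    then have "c * parabola N (B - {x}) \<le> 1 * parabola N (B - {x})"
      using that by (intro mult_right_mono) auto
    then show ?thesis using rem[of x] site_sq_le[OF that(2)] by auto
  qed
  \<comment> \<open>\<open>N + 1 / 2\<close> is what each end site contributes after halving the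
    telescoped sum; at \<open>N\<close> this includes the bond-count correction.\<close>
  moreover have "real N + 1 / 2 \<le> 2 * (real N)\<^sup>2"
  proof -
    have "real N * 1 \<le> real N * real N" using N by (intro mult_left_mono) auto
    moreover have "1 \<le> real N" using N by simp
    ultimately show ?thesis unfolding power2_eq_square by linarith
  qed
  then have "(real N + 1 / 2) * of_bool (x \<in> B) \<le> 2 * (real N)\<^sup>2 * of_bool (x \<in> B)" for x
    by (intro mult_right_mono) auto
  note this[of "int N"] this[of "- int N"]
  moreover have "int N \<in> sites N" "- int N \<in> sites N" by (auto simp: sites_def)
  note kill[OF b this(1)] kill[OF a this(2)]
  ultimately show ?thesis
    unfolding dual_gen_def P_def by (simp add: algebra_simps)
qed

section \<open>Supersolution for the exclusion error\<close>

text \<open>The constant exceeds the largest distance \<open>2 * N\<close> by one, so every pair of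
  distinct sites weighs at least 1; this is what a killing gains per partner.\<close>

definition pair_weight :: "nat \<Rightarrow> int \<Rightarrow> int \<Rightarrow> real" where
  "pair_weight N x y = (if x = y then 0 else 2 * N + 1 - \<bar>x - y\<bar>)"

definition pairs :: "nat \<Rightarrow> int set \<Rightarrow> real" where
  "pairs N B = 1 / 2 * (\<Sum>x\<in>B. \<Sum>y\<in>B. pair_weight N x y)"

lemma pairs_insert:
  assumes "finite C" "x \<notin> C"
  shows "pairs N (insert x C) = pairs N C + (\<Sum>y\<in>C. pair_weight N x y)"
proof -
  have "(\<Sum>y\<in>C. pair_weight N y x) = (\<Sum>y\<in>C. pair_weight N x y)"
    by (intro sum.cong) (auto simp: pair_weight_def)
  moreover have "pair_weight N x x = 0" by (simp add: pair_weight_def)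
  ultimately show ?thesis
    using assms by (simp add: pairs_def sum.distrib algebra_simps)
qed

lemma pair_weight_bounds:
  assumes "x \<in> sites N" "y \<in> sites N"
  shows "0 \<le> pair_weight N x y" "pair_weight N x y \<le> 2 * real N + 1" "x \<noteq> y \<Longrightarrow> 1 \<le> pair_weight N x y"
  using assms by (auto simp: pair_weight_def sites_def)

lemma pairs_bounds:
  assumes "B \<subseteq> sites N"
  shows "0 \<le> pairs N B" "pairs N B \<le> (2 * real N + 1) * (real (card B))\<^sup>2"
proof -
  show nn: "0 \<le> pairs N B"
    unfolding pairs_def using assms by (intro mult_nonneg_nonneg sum_nonneg pair_weight_bounds) auto
  have "pairs N B \<le> 2 * pairs N B" using nn by simp
  also have "\<dots> \<le> (\<Sum>x\<in>B. \<Sum>y\<in>B. 2 * real N + 1)"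
    unfolding pairs_def
    using assms by (simp del: sum_constant) (intro sum_mono pair_weight_bounds(2); auto)
  also have "\<dots> = (2 * real N + 1) * (real (card B))\<^sup>2" by (simp add: power2_eq_square mult_ac)
  finally show "pairs N B \<le> (2 * real N + 1) * (real (card B))\<^sup>2" by simp
qed

text \<open>Away from the ends, the mean distance of two particles changes only while they are
  adjacent: exclusion leaves them just the outward moves, which lowers the weight at rate 1. At an
  end site the missing outward jump costs at most half of \<open>card B - 1\<close>, and killing
  pays for it.\<close>

lemma dual_gen_pairs:
  assumes B: "B \<subseteq> sites N" and a: "a \<in> {0..1}" and b: "b \<in> {0..1}"
  shows "dual_gen N a b (pairs N) B \<le> - adjacent_pairs N B"
proof -
  have fin: "finite B" using B finite_subset by (auto simp: sites_def)
  \<comment> \<open>Particles to the right of \<open>x\<close> minus those to the left: the change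
    of \<open>pairs\<close> when a particle at \<open>x\<close> jumps to an empty
    \<open>x + 1\<close>.\<close>
  define Q :: "int \<Rightarrow> real" where "Q x = (\<Sum>y\<in>B. sgn (of_int (y - x)))" for x
  define P where "P x = of_bool (x \<in> B) * Q x" for x
  have rem: "pairs N B = pairs N (B - {x}) + (\<Sum>y\<in>B - {x}. pair_weight N x y)" if "x \<in> B" for x
    using pairs_insert[of "B - {x}" x N] that fin by (simp add: insert_absorb)
  have Q_rem: "Q x = (\<Sum>y\<in>B - {x}. sgn (of_int (y - x)))" for x
    unfolding Q_def using fin by (cases "x \<in> B") (auto simp: sum.remove)
  \<comment> \<open>Since \<open>sgn 0 = 0\<close>, passing from \<open>x\<close> to
    \<open>x + 1\<close> lowers exactly the terms at \<open>y = x\<close> (0 to -1) and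
    \<open>y = x + 1\<close> (1 to 0).\<close>
  have Q_step: "Q x = Q (x + 1) + of_bool (x \<in> B) + of_bool (x + 1 \<in> B)" for x
  proof -
    have "Q x = (\<Sum>y\<in>B. sgn (of_int (y - (x + 1))) + of_bool (y = x) + of_bool (y = x + 1))"
      unfolding Q_def by (intro sum.cong) (auto simp: sgn_if)
    also have "\<dots> = Q (x + 1) + of_bool (x \<in> B) + of_bool (x + 1 \<in> B)"
      using fin by (simp add: sum.distrib Q_def sum_of_bool_eq)
    finally show ?thesis .
  qed
  have bond: "pairs N (swap x B) - pairs N B = (P x - P (x + 1)) - 2 * of_bool (x \<in> B \<and> x + 1 \<in> B)" for x
  proof (cases rule: swap_cases[where x = x and B = B])
    case right
    have "pairs N (swap x B) - pairs N B = (\<Sum>y\<in>B - {x}. pair_weight N (x + 1) y - pair_weight N x y)"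
      unfolding right(3) using right fin by (simp add: pairs_insert rem[OF right(1)] sum_subtractf)
    also have "\<dots> = (\<Sum>y\<in>B - {x}. sgn (of_int (y - x)))"
    proof (intro sum.cong refl)
      fix y assume "y \<in> B - {x}"
      then have "y \<noteq> x" "y \<noteq> x + 1" using right by auto
      then show "pair_weight N (x + 1) y - pair_weight N x y = sgn (of_int (y - x))"
        by (cases "y < x") (auto simp: pair_weight_def)
    qed
    finally show ?thesis using right by (simp add: P_def Q_rem)
  next
    case left
    have "pairs N (swap x B) - pairs N B = (\<Sum>y\<in>B - {x + 1}. pair_weight N x y - pair_weight N (x + 1) y)"
      unfolding left(3) using left fin by (simp add: pairs_insert rem[OF left(2)] sum_subtractf)
    also have "\<dots> = (\<Sum>y\<in>B - {x + 1}. - sgn (of_int (y - (x + 1))))"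
    proof (intro sum.cong refl)
      fix y assume "y \<in> B - {x + 1}"
      then have "y \<noteq> x" "y \<noteq> x + 1" using left by auto
      then show "pair_weight N x y - pair_weight N (x + 1) y = - sgn (of_int (y - (x + 1)))"
        by (cases "y < x") (auto simp: pair_weight_def)
    qed
    finally show ?thesis using left by (simp add: P_def Q_rem[of "x + 1"] sum_negf)
  next
    case id
    then show ?thesis using Q_step[of x] by (simp add: P_def)
  qed
  have "(\<Sum>x = - int N..int N - 1. pairs N (swap x B) - pairs N B)
    = P (- int N) - P (int N) - 2 * adjacent_pairs N B"
    unfolding bond
    by (simp add: sum_subtractf[of "\<lambda>x. P x - P (x + 1)"] sum_telescope_int adjacent_pairs_def sum_distrib_left)
  moreover have P_le: "P (- int N) \<le> of_bool (- int N \<in> B) * (real (card B) - 1)"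
    "- P (int N) \<le> of_bool (int N \<in> B) * (real (card B) - 1)"
  proof -
    have *: "\<bar>Q x\<bar> \<le> real (card B) - 1" if "x \<in> B" for x
    proof -
      have "\<bar>Q x\<bar> \<le> (\<Sum>y\<in>B - {x}. 1)"
        unfolding Q_rem by (rule order_trans[OF sum_abs], intro sum_mono) (simp add: sgn_if)
      then show ?thesis using card_Suc_Diff1[OF fin that] by simp
    qed
    show "P (- int N) \<le> of_bool (- int N \<in> B) * (real (card B) - 1)"
     "- P (int N) \<le> of_bool (int N \<in> B) * (real (card B) - 1)"
      using *[of "- int N"] *[of "int N"] by (auto simp: P_def)
  qed
  moreover have kill: "of_bool (x \<in> B) * (c * pairs N (B - {x}) - pairs N B) \<le> - of_bool (x \<in> B) * (real (card B) - 1)"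
    if "c \<in> {0..1}" "x \<in> sites N" for c x
  proof (cases "x \<in> B")
    case True
    have "0 \<le> pairs N (B - {x})" using B by (intro pairs_bounds) auto
    then have "c * pairs N (B - {x}) \<le> 1 * pairs N (B - {x})"
      using that by (intro mult_right_mono) auto
    moreover have "(\<Sum>y\<in>B - {x}. 1) \<le> (\<Sum>y\<in>B - {x}. pair_weight N x y)"
      using that B by (intro sum_mono pair_weight_bounds) auto
    then have "real (card B) - 1 \<le> (\<Sum>y\<in>B - {x}. pair_weight N x y)"
      using fin True by (simp add: card_Diff_singleton of_nat_diff card_gt_0_iff Suc_le_eq)
    ultimately show ?thesis using rem[OF True] True by simp
  qed simp
  \<comment> \<open>The end terms enter halved while the killing gain enters in full; the surplus
    half must have the right sign.\<close>
  moreover have "0 \<le> of_bool (x \<in> B) * (real (card B) - 1)" for x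
    using fin card_gt_0_iff[of B] by auto
  note this[of "int N"] this[of "- int N"]
  moreover have "int N \<in> sites N" "- int N \<in> sites N" by (auto simp: sites_def)
  note kill[OF b this(1)] kill[OF a this(2)]
  ultimately show ?thesis
    unfolding dual_gen_def by (simp add: algebra_simps)
qed

section \<open>Correlation estimate\<close>

lemma dual_gen_scale: "dual_gen N a b (\<lambda>C. c * D C) B = c * dual_gen N a b D B"
  using dual_gen_linear[of N a b c D "\<lambda>_. 0" B] by (simp add: dual_gen_def)

lemma expectation_dual_gen:
  assumes "finite (set_pmf p)"
  shows "measure_pmf.expectation p (\<lambda>\<eta>. dual_gen N a b (\<lambda>C. D C \<eta>) B) =
    dual_gen N a b (\<lambda>C. measure_pmf.expectation p (D C)) B"
proof -
  have "integrable (measure_pmf p) f" for f :: "'a \<Rightarrow> real"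
    using assms by (rule integrable_measure_pmf_finite)
  then show ?thesis unfolding dual_gen_def by simp
qed

lemma finite_configs: "finite (configs N)"
  unfolding configs_def by (intro finite_PiE) (auto simp: sites_def)

lemma occupied_in_unit: "occupied B \<eta> \<in> {0..1}"
  unfolding occupied_def by (auto intro!: prod_nonneg prod_le_1)

lemma prod_profile_in_unit:
  assumes "a \<in> {0..1}" "b \<in> {0..1}" "B \<subseteq> sites N"
  shows "(\<Prod>x\<in>B. profile N a b x) \<in> {0..1}"
  using profile_in_unit[OF assms(1,2)] assms(3) by (auto intro!: prod_nonneg prod_le_1)

lemma prod_profile_lipschitz:
  fixes a a' b b' d :: real
  assumes "a \<in> {0..1}" "b \<in> {0..1}" "a' \<in> {0..1}" "b' \<in> {0..1}"
    "\<bar>a - a'\<bar> \<le> d" "\<bar>b - b'\<bar> \<le> d" "B \<subseteq> sites N"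
  shows "\<bar>(\<Prod>x\<in>B. profile N a b x) - (\<Prod>x\<in>B. profile N a' b' x)\<bar> \<le> card B * d"
proof -
  have "norm ((\<Prod>x\<in>B. profile N a b x) - (\<Prod>x\<in>B. profile N a' b' x))
     \<le> (\<Sum>x\<in>B. norm (profile N a b x - profile N a' b' x))"
    using profile_in_unit[OF assms(1,2)] profile_in_unit[OF assms(3,4)] assms(7)
    by (intro norm_prod_diff) auto
  also have "\<dots> \<le> (\<Sum>x\<in>B. d)"
    using profile_lipschitz[OF assms(5,6)] assms(7) by (intro sum_mono) auto
  finally show ?thesis by simp
qed

text \<open>Rate 1/3: as \<open>parabola\<close> is at most \<open>3 * N\<^sup>2 * card B\<close>,
  the decay of the exponential weight costs no more than the drift \<open>- card B\<close> supplies.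
  In \<open>L + 1\<close>, the \<open>L\<close> pays for the motion of the profile and the 1 makes
  the inequality strict.\<close>

definition barrier :: "nat \<Rightarrow> real \<Rightarrow> real \<Rightarrow> int set \<Rightarrow> real \<Rightarrow> real" where
  "barrier N \<alpha> L B s =
     (exp (- (N powr \<alpha> * s / 3)) / (real N)\<^sup>2 + (L + 1) / N powr (2 + \<alpha>)) * parabola N B +
     1 / (real N)\<^sup>2 * pairs N B"

lemma correlation_estimate:
  fixes \<rho>m \<rho>p :: "real \<Rightarrow> real"
  assumes N: "N > 0"
    and K: "transition_family (configs N) K" "has_generator (configs N) K (L_full \<alpha> \<rho>m \<rho>p N)"
    and \<eta>0: "\<eta>0 \<in> configs N"
    and unit: "\<And>s. 0 \<le> s \<Longrightarrow> \<rho>m s \<in> {0..1}" "\<And>s. 0 \<le> s \<Longrightarrow> \<rho>p s \<in> {0..1}"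
    and lip: "L-lipschitz_on {0..} \<rho>m" "L-lipschitz_on {0..} \<rho>p"
    and "B \<subseteq> sites N" "0 \<le> t"
  shows "\<bar>measure_pmf.expectation (K 0 t \<eta>0) (occupied B) - (\<Prod>x\<in>B. profile N (\<rho>m t) (\<rho>p t) x)\<bar>
    \<le> barrier N \<alpha> L B t"
proof -
  define u where "u B s = measure_pmf.expectation (K 0 s \<eta>0) (occupied B)" for B s
  define v where "v B s = (\<Prod>x\<in>B. profile N (\<rho>m s) (\<rho>p s) x)" for B s
  have L0: "0 \<le> L" using lip(1) by (rule lipschitz_on_nonneg)
  have N1: "real N > 0" using N by simp
  have fin_sites: "finite B" if "B \<subseteq> sites N" for B
    using that finite_subset by (auto simp: sites_def)
  have u_empty: "u {} s = 1" for s by (simp add: u_def occupied_def[abs_def])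
  have barrier_empty: "barrier N \<alpha> L {} s = 0" for s by (simp add: barrier_def parabola_def pairs_def)
  have u_deriv: "(u B has_real_derivative real N powr (2 + \<alpha>) * dual_gen N (\<rho>m s) (\<rho>p s) (\<lambda>C. u C s) B)
      (at_right s)" if "B \<subseteq> sites N" "0 \<le> s" for B s
  proof -
    have "set_pmf (K 0 s \<eta>0) \<subseteq> configs N"
      using K(1) \<eta>0 that unfolding transition_family_def by auto
    then have "finite (set_pmf (K 0 s \<eta>0))" using finite_configs finite_subset by blast
    note E = expectation_dual_gen[OF this, of N "\<rho>m s" "\<rho>p s" occupied B]
    show ?thesis
      using forward_equation[OF K finite_configs \<eta>0 that(2), of "occupied B"]
      unfolding L_full_occupied[OF fin_sites[OF that(1)]] u_def E[symmetric] by simp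
  qed
  \<comment> \<open>The sign \<open>\<sigma>\<close> treats the upper and the lower bound at
    once.\<close>
  have bound: "\<sigma> * (u B t - v B t) - barrier N \<alpha> L B t \<le> 0"
    if \<sigma>: "\<sigma> = 1 \<or> \<sigma> = - 1" and B: "B \<subseteq> sites N" and t: "0 \<le> t" for \<sigma> :: real and B t
  proof (rule comparison_principle[where I = "Pow (sites N)" and i = B
        and w = "\<lambda>B s. \<sigma> * (u B s - v B s) - barrier N \<alpha> L B s"])
    show "finite (Pow (sites N))" by (simp add: sites_def)
    show "B \<in> Pow (sites N)" using B by simp
    show "0 \<le> t" by fact
    show "continuous_on {0..} (\<lambda>s. \<sigma> * (u B s - v B s) - barrier N \<alpha> L B s)" for B
    proof -
      have "continuous_on {0..} (u B)"
        unfolding u_def by (rule continuous_on_expectation[OF K finite_configs \<eta>0])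
      moreover have "continuous_on {0..} (v B)"
        unfolding v_def profile_def using lip[THEN lipschitz_on_continuous_on]
        by (intro continuous_on_prod continuous_on_add continuous_on_mult continuous_on_diff
            continuous_on_divide continuous_on_const) auto
      moreover have "continuous_on {0..} (\<lambda>s. (exp (- (c * s / 3)) / (real N)\<^sup>2 + d) * h + w)"
        for c d h w :: real
        using N1 by (intro continuous_intros) auto
      then have "continuous_on {0..} (barrier N \<alpha> L B)"
        unfolding barrier_def .
      ultimately show ?thesis
        by (intro continuous_on_diff continuous_on_mult continuous_on_const)
    qed
  next
    fix B assume "B \<in> Pow (sites N)"
    then have B: "B \<subseteq> sites N" by simp
    show "\<sigma> * (u B 0 - v B 0) - barrier N \<alpha> L B 0 \<le> 0"
    proof (cases "B = {}")
      case True
      then show ?thesis by (simp add: u_empty barrier_empty v_def)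
    next
      case False
      have "K 0 0 \<eta>0 = return_pmf \<eta>0" using K(1) \<eta>0 unfolding transition_family_def by simp
      then have "u B 0 \<in> {0..1}" using occupied_in_unit[of B \<eta>0] by (simp add: u_def)
      moreover have "v B 0 \<in> {0..1}" unfolding v_def using unit B by (intro prod_profile_in_unit) auto
      ultimately have "\<sigma> * (u B 0 - v B 0) \<le> 1" using \<sigma> by auto
      also have "1 \<le> real (card B)" using False fin_sites[OF B] by (simp add: Suc_le_eq card_gt_0_iff)
      also have "real (card B) \<le> 1 / (real N)\<^sup>2 * (2 * (real N)\<^sup>2 * card B)" using N1 by simp
      also have "\<dots> \<le> 1 / (real N)\<^sup>2 * parabola N B"
        by (intro mult_left_mono parabola_bounds B) simp
      also have "\<dots> \<le> (1 / (real N)\<^sup>2 + (L + 1) / N powr (2 + \<alpha>)) * parabola N B"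
        using L0 order_trans[OF _ parabola_bounds(1)[OF B]] by (intro mult_right_mono) auto
      also have "\<dots> \<le> barrier N \<alpha> L B 0"
        unfolding barrier_def using pairs_bounds(1)[OF B] by simp
      finally show ?thesis by simp
    qed
  next
    fix B s
    assume "B \<in> Pow (sites N)" and s: "0 \<le> s"
      and zero: "\<sigma> * (u B s - v B s) - barrier N \<alpha> L B s = 0"
      and le: "\<And>C. C \<in> Pow (sites N) \<Longrightarrow> \<sigma> * (u C s - v C s) - barrier N \<alpha> L C s \<le> 0"
    then have B: "B \<subseteq> sites N" by simp
    show "\<forall>\<^sub>F s' in at_right s. \<sigma> * (u B s' - v B s') - barrier N \<alpha> L B s' \<le> 0"
    \<comment> \<open>Strictness below comes from \<open>card B > 0\<close>. For the empty set,
      \<open>u\<close> and \<open>v\<close> are both 1 and the barrier is 0.\<close>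
    proof (cases "B = {}")
      case True
      then show ?thesis by (simp add: u_empty barrier_empty v_def)
    next
      case False
      then have k: "real (card B) > 0" using fin_sites[OF B] by (simp add: card_gt_0_iff)
      let ?a = "\<rho>m s" and ?b = "\<rho>p s"
      note ab = unit[OF s]
      define e where "e = exp (- (N powr \<alpha> * s / 3))"
      define q where "q = e / (real N)\<^sup>2 + (L + 1) / N powr (2 + \<alpha>)"
      define G where "G = dual_gen N ?a ?b (\<lambda>C. u C s) B"
      have N2: "N powr (2 + \<alpha>) = N powr \<alpha> * (real N)\<^sup>2"
        using N1 by (simp add: powr_add powr_numeral mult.commute)
      have q: "N powr (2 + \<alpha>) * q = N powr \<alpha> * e + (L + 1)"
      proof -
        have "N powr (2 + \<alpha>) * ((L + 1) / N powr (2 + \<alpha>)) = L + 1" using N1 by simp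
        moreover have "N powr (2 + \<alpha>) * (e / (real N)\<^sup>2) = N powr \<alpha> * e" unfolding N2 using N1 by simp
        ultimately show ?thesis unfolding q_def distrib_left by simp
      qed
      have q0: "0 \<le> q" using L0 by (simp add: q_def e_def)
      have barrier_eq: "barrier N \<alpha> L C s = q * parabola N C + 1 / (real N)\<^sup>2 * pairs N C" for C
        by (simp add: barrier_def q_def e_def)
      have "\<sigma> * G = dual_gen N ?a ?b (\<lambda>C. \<sigma> * u C s) B"
        by (simp add: G_def dual_gen_scale)
      \<comment> \<open>At a touching time \<open>\<sigma> * u\<close> lies below
        \<open>\<sigma> * v\<close> plus the barrier at every set, with equality at
        \<open>B\<close>.\<close>
      also have "\<dots> \<le> dual_gen N ?a ?b (\<lambda>C. \<sigma> * v C s + (q * parabola N C + 1 / (real N)\<^sup>2 * pairs N C)) B"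
        unfolding barrier_eq[symmetric]
      proof (intro dual_gen_mono B)
        show "\<sigma> * u C s \<le> \<sigma> * v C s + barrier N \<alpha> L C s" if "C \<subseteq> sites N" for C
          using le[of C] that by (simp add: algebra_simps)
        show "\<sigma> * u B s = \<sigma> * v B s + barrier N \<alpha> L B s"
          using zero by (simp add: algebra_simps)
      qed (use ab in auto)
      also have "\<dots> = \<sigma> * dual_gen N ?a ?b (\<lambda>C. v C s) B +
         (q * dual_gen N ?a ?b (parabola N) B + 1 / (real N)\<^sup>2 * dual_gen N ?a ?b (pairs N) B)"
        by (simp only: dual_gen_linear dual_gen_scale)
      \<comment> \<open>The exclusion error of the profile and the drift of \<open>pairs\<close>
        cancel, leaving only the \<open>parabola\<close> term.\<close>
      also have "\<dots> \<le> adjacent_pairs N B / (real N)\<^sup>2 + (q * (- real (card B)) + 1 / (real N)\<^sup>2 * (- adjacent_pairs N B))"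
      proof (intro add_mono mult_left_mono dual_gen_parabola dual_gen_pairs B N ab q0)
        show "\<sigma> * dual_gen N ?a ?b (\<lambda>C. v C s) B \<le> adjacent_pairs N B / (real N)\<^sup>2"
          using dual_gen_profile[OF B ab N] \<sigma> unfolding v_def by auto
      qed simp
      finally have "\<sigma> * G \<le> - q * card B" by simp
      then have "N powr (2 + \<alpha>) * (\<sigma> * G) \<le> N powr (2 + \<alpha>) * (- q * card B)"
        by (intro mult_left_mono) auto
      also have "\<dots> = - (N powr \<alpha> * e + (L + 1)) * card B"
        unfolding q[symmetric] by simp
      finally have uG: "\<sigma> * (N powr (2 + \<alpha>) * G) \<le> - (N powr \<alpha> * e + (L + 1)) * card B"
        by (simp add: mult_ac)
      \<comment> \<open>The profile is only Lipschitz in time and need not be differentiable, so its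
        variation after \<open>s\<close> is replaced by the linear majorant
        \<open>L * card B * (r - s)\<close>.\<close>
      define \<psi> where "\<psi> r = \<sigma> * u B r + L * card B * (r - s) - barrier N \<alpha> L B r" for r
      define \<psi>' where "\<psi>' = \<sigma> * (N powr (2 + \<alpha>) * G) + L * card B +
          N powr \<alpha> / 3 * e / (real N)\<^sup>2 * parabola N B"
      have "(\<psi> has_real_derivative \<psi>') (at_right s)"
      proof -
        have "((\<lambda>r. (exp (- (c * r / 3)) / (real N)\<^sup>2 + f) * h + w) has_real_derivative
           - (c / 3) * exp (- (c * s / 3)) / (real N)\<^sup>2 * h) (at_right s)" for c f h w :: real
          using N1 by (auto intro!: derivative_eq_intros simp: field_simps power4_eq_xxxx power2_eq_square)
        from this[of "N powr \<alpha>"]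
        have "(barrier N \<alpha> L B has_real_derivative - (N powr \<alpha> / 3) * e / (real N)\<^sup>2 * parabola N B) (at_right s)"
          unfolding barrier_def e_def .
        moreover have "((\<lambda>r. L * card B * (r - s)) has_real_derivative L * card B) (at_right s)"
          by (auto intro!: derivative_eq_intros)
        ultimately have "(\<psi> has_real_derivative \<sigma> * (N powr (2 + \<alpha>) * G) + L * card B
            - (- (N powr \<alpha> / 3) * e / (real N)\<^sup>2 * parabola N B)) (at_right s)"
          unfolding \<psi>_def G_def by (intro DERIV_diff DERIV_add DERIV_cmult u_deriv B s)
        then show ?thesis by (simp add: \<psi>'_def)
      qed
      moreover have "\<psi>' < 0"
      proof -
        have "N powr \<alpha> / 3 * e / (real N)\<^sup>2 * parabola N B \<le>
            N powr \<alpha> / 3 * e / (real N)\<^sup>2 * (3 * (real N)\<^sup>2 * card B)"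
          by (intro mult_left_mono parabola_bounds B) (simp add: e_def)
        also have "\<dots> = N powr \<alpha> * e * card B" using N1 by simp
        finally have "\<psi>' \<le> - real (card B)"
          unfolding \<psi>'_def using uG by (simp add: algebra_simps)
        then show ?thesis using k by simp
      qed
      ultimately obtain d where d: "d > 0" "\<And>h. h > 0 \<Longrightarrow> s + h \<in> {s<..} \<Longrightarrow> h < d \<Longrightarrow> \<psi> (s + h) < \<psi> s"
        using has_real_derivative_neg_dec_right[of \<psi> \<psi>' s "{s<..}"] by blast
      have "\<sigma> * (u B r - v B r) - barrier N \<alpha> L B r \<le> 0" if r: "s < r" "r < s + d" for r
      proof -
        have "\<bar>v B r - v B s\<bar> \<le> card B * (L * (r - s))"
          unfolding v_def using unit s r B lip[THEN lipschitz_onD, of r s]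
          by (intro prod_profile_lipschitz) (auto simp: dist_real_def)
        then have "- \<sigma> * (v B r - v B s) \<le> L * card B * (r - s)"
          using \<sigma> by (auto simp: algebra_simps)
        moreover have "\<psi> r < \<psi> s" using d(2)[of "r - s"] r by simp
        ultimately show ?thesis using zero unfolding \<psi>_def by (simp add: algebra_simps)
      qed
      then show ?thesis
        unfolding eventually_at_right_field using d(1) by (intro exI[of _ "s + d"]) auto
    qed
  qed
  show ?thesis
    using bound[of 1 B t] bound[of "- 1" B t] assms(9,10) unfolding u_def v_def by simp
qed

section \<open>Local functions and the limit\<close>

text \<open>Induction on \<open>A\<close>: fixing the occupation of one site \<open>a\<close> gives
  \<open>\<psi> False\<close> and \<open>\<psi> True\<close>, and the function is
  \<open>\<psi> False\<close> plus the indicator of \<open>a\<close> times their difference.\<close>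

lemma multilinear_expansion:
  assumes "finite A" "depends_only_on \<phi> A"
  obtains c where "\<And>\<xi>. \<phi> \<xi> = (\<Sum>C\<in>Pow A. c C * occupied C \<xi>)"
proof -
  have "\<exists>c. \<forall>\<xi>. \<phi> \<xi> = (\<Sum>C\<in>Pow A. c C * occupied C \<xi>)"
    using assms
  proof (induction A arbitrary: \<phi>)
    case empty
    then have "\<phi> \<xi> = \<phi> undefined" for \<xi> unfolding depends_only_on_def by blast
    then show ?case by (intro exI[of _ "\<lambda>_. \<phi> undefined"]) (auto simp: occupied_def)
  next
    case (insert a A)
    define \<psi> where "\<psi> b \<xi> = \<phi> (\<xi>(a := b))" for b \<xi>
    have "depends_only_on (\<psi> b) A" for b
      using insert.prems unfolding depends_only_on_def \<psi>_def by simp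
    then have "\<forall>b. \<exists>c. \<forall>\<xi>. \<psi> b \<xi> = (\<Sum>C\<in>Pow A. c C * occupied C \<xi>)"
      using insert.IH by blast
    then obtain c where c: "\<psi> b \<xi> = (\<Sum>C\<in>Pow A. c b C * occupied C \<xi>)" for b \<xi>
      by metis
    define d where "d C = (if a \<in> C then c True (C - {a}) - c False (C - {a}) else c False C)" for C
    have "\<phi> \<xi> = (\<Sum>C\<in>Pow (insert a A). d C * occupied C \<xi>)" for \<xi>
    proof -
      have inj: "inj_on (insert a) (Pow A)" using insert.hyps by (auto simp: inj_on_def)
      have "(\<Sum>C\<in>Pow (insert a A). d C * occupied C \<xi>) =
         (\<Sum>C\<in>Pow A. d C * occupied C \<xi>) + (\<Sum>C\<in>insert a ` Pow A. d C * occupied C \<xi>)"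
        unfolding Pow_insert using insert.hyps by (intro sum.union_disjoint) auto
      also have "(\<Sum>C\<in>insert a ` Pow A. d C * occupied C \<xi>) =
          (\<Sum>C\<in>Pow A. d (insert a C) * occupied (insert a C) \<xi>)"
        by (simp add: sum.reindex[OF inj])
      also have "\<dots> = (\<Sum>C\<in>Pow A. (c True C - c False C) * (of_bool (\<xi> a) * occupied C \<xi>))"
      proof (intro sum.cong refl)
        fix C assume "C \<in> Pow A"
        then have "finite C" "a \<notin> C" using insert.hyps finite_subset by auto
        then show "d (insert a C) * occupied (insert a C) \<xi> =
            (c True C - c False C) * (of_bool (\<xi> a) * occupied C \<xi>)"
          by (simp add: d_def occupied_def)
      qed
      also have "(\<Sum>C\<in>Pow A. d C * occupied C \<xi>) = \<psi> False \<xi>"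
        unfolding c using insert.hyps by (intro sum.cong refl) (auto simp: d_def)
      also have "(\<Sum>C\<in>Pow A. (c True C - c False C) * (of_bool (\<xi> a) * occupied C \<xi>)) =
         of_bool (\<xi> a) * (\<psi> True \<xi> - \<psi> False \<xi>)"
        unfolding c by (cases "\<xi> a") (simp_all add: sum_subtractf left_diff_distrib)
      also have "\<psi> False \<xi> + of_bool (\<xi> a) * (\<psi> True \<xi> - \<psi> False \<xi>) = \<psi> (\<xi> a) \<xi>"
        by (cases "\<xi> a") auto
      also have "\<psi> (\<xi> a) \<xi> = \<phi> \<xi>" by (simp add: \<psi>_def)
      finally show ?thesis by simp
    qed
    then show ?case by blast
  qed
  then show ?thesis using that by blast
qed

text \<open>The event that \<open>C\<close> is filled is a cylinder set. Integrability is recorded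
  for splitting the integral over the multilinear expansion.\<close>

lemma bernoulli_occupied:
  assumes "\<rho> \<in> {0..1}" "finite C"
  shows "integrable (PiM UNIV (\<lambda>_. measure_pmf (bernoulli_pmf \<rho>))) (occupied C)"
    and "bernoulli_expectation \<rho> (occupied C) = \<rho> ^ card C"
proof -
  let ?P = "PiM (UNIV :: int set) (\<lambda>_. measure_pmf (bernoulli_pmf \<rho>))"
  interpret product_prob_space "\<lambda>_. measure_pmf (bernoulli_pmf \<rho>)" "UNIV :: int set"
    by standard
  define E where "E = emb UNIV C (Pi\<^sub>E C (\<lambda>_. {True}))"
  have E: "E = {\<xi>. \<forall>x\<in>C. \<xi> x}"
    by (auto simp: E_def prod_emb_def space_PiM fun_eq_iff restrict_def split: if_splits)
  have sets: "E \<in> sets ?P"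
    unfolding E_def using assms(2) by (intro sets_PiM_I) auto
  have "measure ?P E = (\<Prod>x\<in>C. measure (bernoulli_pmf \<rho>) {True})"
    unfolding E_def using assms(2) by (intro measure_PiM_emb) auto
  also have "\<dots> = \<rho> ^ card C"
    using assms(1) by (simp add: measure_pmf_single)
  finally have m: "measure ?P E = \<rho> ^ card C" .
  have occ: "occupied C = indicator E"
    using assms(2) by (auto simp: fun_eq_iff occupied_def E indicator_def prod_zero_iff)
  show "integrable ?P (occupied C)"
    unfolding occ using sets by (simp add: integrable_indicator_iff less_top[symmetric])
  show "bernoulli_expectation \<rho> (occupied C) = \<rho> ^ card C"
    unfolding bernoulli_expectation_def occ using sets m by simp
qed

section \<open>Passage to the limit\<close>

text \<open>The bound sees \<open>B\<close> only through its cardinality, hence is uniform over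
  translates.\<close>

lemma barrier_le:
  fixes \<alpha> L s :: real
  assumes "B \<subseteq> sites N" "N > 0" "0 \<le> L"
  shows "barrier N \<alpha> L B s \<le> 3 * card B * exp (- (N powr \<alpha> * s / 3)) + 3 * card B * (L + 1) * N powr (- \<alpha>)
     + (real (card B))\<^sup>2 * ((2 * real N + 1) / (real N)\<^sup>2)"
proof -
  have N2: "N powr (2 + \<alpha>) = N powr \<alpha> * (real N)\<^sup>2"
    using assms by (simp add: powr_add powr_numeral mult.commute)
  have "barrier N \<alpha> L B s \<le>
     (exp (- (N powr \<alpha> * s / 3)) / (real N)\<^sup>2 + (L + 1) / N powr (2 + \<alpha>)) * (3 * (real N)\<^sup>2 * card B) +
     1 / (real N)\<^sup>2 * ((2 * real N + 1) * (real (card B))\<^sup>2)"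
    unfolding barrier_def using assms
    by (intro add_mono mult_left_mono parabola_bounds pairs_bounds add_nonneg_nonneg divide_nonneg_nonneg) auto
  also have "\<dots> = 3 * card B * exp (- (N powr \<alpha> * s / 3)) + 3 * card B * (L + 1) * N powr (- \<alpha>)
     + (real (card B))\<^sup>2 * ((2 * real N + 1) / (real N)\<^sup>2)"
    unfolding N2 powr_minus using assms by (simp add: field_simps)
  finally show ?thesis .
qed

lemma barrier_bound_tendsto_zero:
  fixes \<alpha> t c d f :: real
  assumes "\<alpha> > 0" "t > 0"
  shows "(\<lambda>N. c * exp (- (real N powr \<alpha> * t / 3)) + d * real N powr (- \<alpha>)
     + f * ((2 * real N + 1) / (real N)\<^sup>2)) \<longlonglongrightarrow> 0"
proof -
  have "(\<lambda>N. exp (- (real N powr \<alpha> * t / 3))) \<longlonglongrightarrow> 0" using assms by real_asymp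
  moreover have "(\<lambda>N. real N powr (- \<alpha>)) \<longlonglongrightarrow> 0" using assms by real_asymp
  moreover have "(\<lambda>N. (2 * real N + 1) / (real N)\<^sup>2) \<longlonglongrightarrow> 0" by real_asymp
  ultimately have "(\<lambda>N. c * exp (- (real N powr \<alpha> * t / 3)) + d * real N powr (- \<alpha>)
     + f * ((2 * real N + 1) / (real N)\<^sup>2)) \<longlonglongrightarrow> c * 0 + d * 0 + f * 0"
    by (intro tendsto_add tendsto_mult tendsto_const)
  then show ?thesis by simp
qed

lemma floor_mult_over_tendsto:
  "(\<lambda>N. real_of_int (x + \<lfloor>real N * r\<rfloor>) / (2 * real N + 1)) \<longlonglongrightarrow> r / 2"
proof (rule tendsto_sandwich)
  show "(\<lambda>N. (x + real N * r - 1) / (2 * real N + 1)) \<longlonglongrightarrow> r / 2" by real_asymp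
  show "(\<lambda>N. (x + real N * r) / (2 * real N + 1)) \<longlonglongrightarrow> r / 2" by real_asymp
  show "\<forall>\<^sub>F N in sequentially. (x + real N * r - 1) / (2 * real N + 1)
      \<le> real_of_int (x + \<lfloor>real N * r\<rfloor>) / (2 * real N + 1)"
  proof (intro always_eventually allI divide_right_mono)
    show "x + real N * r - 1 \<le> real_of_int (x + \<lfloor>real N * r\<rfloor>)" for N
      using floor_correct[of "real N * r"] by simp
  qed simp
  show "\<forall>\<^sub>F N in sequentially. real_of_int (x + \<lfloor>real N * r\<rfloor>) / (2 * real N + 1)
      \<le> (x + real N * r) / (2 * real N + 1)"
    by (intro always_eventually allI divide_right_mono) auto
qed

lemma profile_tendsto_rho_bar:
  "(\<lambda>N. profile N (\<rho>m t) (\<rho>p t) (x + \<lfloor>real N * r\<rfloor>)) \<longlonglongrightarrow> rho_bar \<rho>m \<rho>p r t"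
proof -
  have "(\<lambda>N. (\<rho>m t + \<rho>p t) / 2 + (\<rho>p t - \<rho>m t) * (real_of_int (x + \<lfloor>real N * r\<rfloor>) / (2 * real N + 1)))
     \<longlonglongrightarrow> (\<rho>m t + \<rho>p t) / 2 + (\<rho>p t - \<rho>m t) * (r / 2)"
    by (intro tendsto_intros floor_mult_over_tendsto)
  then show ?thesis
    by (simp add: profile_def rho_bar_def algebra_simps)
qed

lemma shift_well_defined_eventually:
  assumes "finite A" "\<bar>r\<bar> < 1"
  shows "\<forall>\<^sub>F N in sequentially. shift_well_defined A \<lfloor>real N * r\<rfloor> N"
proof -
  have "\<forall>\<^sub>F N in sequentially. z + \<lfloor>real N * r\<rfloor> \<in> sites N" for z
  proof -
    \<comment> \<open>The distance from \<open>N * r\<close> to the nearer end grows linearly; the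
      extra 1 absorbs the rounding.\<close>
    have "\<forall>\<^sub>F N in sequentially. \<bar>real_of_int z\<bar> + 1 \<le> real N * (1 - \<bar>r\<bar>)"
      using assms(2) by real_asymp
    then show ?thesis
    proof eventually_elim
      case (elim N)
      have "\<bar>real N * r\<bar> = real N * \<bar>r\<bar>" by (simp add: abs_mult)
      then have "\<bar>real N * r\<bar> \<le> real N - \<bar>real_of_int z\<bar> - 1" using elim by (simp add: algebra_simps)
      then show ?case by (simp add: sites_def) linarith
    qed
  qed
  then have "\<forall>\<^sub>F N in sequentially. \<forall>z\<in>A. z + \<lfloor>real N * r\<rfloor> \<in> sites N"
    using assms(1) by (simp add: eventually_ball_finite)
  then show ?thesis
    by eventually_elim (auto simp: shift_well_defined_def)
qed

lemma rho_bar_in_unit: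
  assumes "\<rho>m t \<in> {0<..<1}" "\<rho>p t \<in> {0<..<1}" "r \<in> {-1..1}"
  shows "rho_bar \<rho>m \<rho>p r t \<in> {0..1}"
proof -
  have eq: "rho_bar \<rho>m \<rho>p r t = (1 - r) / 2 * \<rho>m t + (1 + r) / 2 * \<rho>p t"
    by (simp add: rho_bar_def field_simps)
  have "(1 - r) / 2 * \<rho>m t + (1 + r) / 2 * \<rho>p t \<le> (1 - r) / 2 * 1 + (1 + r) / 2 * 1"
    using assms by (intro add_mono mult_left_mono) auto
  moreover have "0 \<le> (1 - r) / 2 * \<rho>m t + (1 + r) / 2 * \<rho>p t" using assms by simp
  ultimately show ?thesis unfolding eq by (simp add: field_simps)
qed

theorem theorem2p1:
  fixes \<rho>m \<rho>p :: "real \<Rightarrow> real" and \<alpha> :: real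
    and M :: "nat \<Rightarrow> 'w measure"
    and \<eta> :: "nat \<Rightarrow> real \<Rightarrow> 'w \<Rightarrow> (int \<Rightarrow> bool)"
    and \<eta>0 :: "nat \<Rightarrow> (int \<Rightarrow> bool)"
    and t r :: real
    and \<phi> :: "(int \<Rightarrow> bool) \<Rightarrow> real" and A :: "int set"
  assumes "\<forall>s\<ge>0. \<rho>m s \<in> {0<..<1}" and "\<exists>C. C-lipschitz_on {0..} \<rho>m"
    and "\<forall>s\<ge>0. \<rho>p s \<in> {0<..<1}" and "\<exists>C. C-lipschitz_on {0..} \<rho>p"
    and "\<alpha> > 0"
    and "\<And>N. \<eta>0 N \<in> configs N"
    and "\<And>N. markov_process_with_generator (M N) (configs N) (L_full \<alpha> \<rho>m \<rho>p N) (\<eta>0 N) (\<eta> N)"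
    and "t > 0" and "r \<in> {-1..1}"
    and "finite A" and "depends_only_on \<phi> A"
  shows "(\<bar>r\<bar> < 1 \<longrightarrow> (\<forall>\<^sub>F N in sequentially. shift_well_defined A \<lfloor>real N * r\<rfloor> N)) \<and>
         ((\<forall>\<^sub>F N in sequentially. shift_well_defined A \<lfloor>real N * r\<rfloor> N) \<longrightarrow>
            (\<lambda>N. prob_space.expectation (M N) (\<lambda>w. shift \<lfloor>real N * r\<rfloor> \<phi> (\<eta> N t w)))
              \<longlonglongrightarrow> bernoulli_expectation (rho_bar \<rho>m \<rho>p r t) \<phi>)"
proof (intro conjI impI)
  assume "\<bar>r\<bar> < 1"
  then show "\<forall>\<^sub>F N in sequentially. shift_well_defined A \<lfloor>real N * r\<rfloor> N"
    using assms(10) shift_well_defined_eventually by blast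
next
  assume wd: "\<forall>\<^sub>F N in sequentially. shift_well_defined A \<lfloor>real N * r\<rfloor> N"
  let ?\<rho> = "rho_bar \<rho>m \<rho>p r t"
  have \<rho>: "?\<rho> \<in> {0..1}" using assms(1,3,8,9) by (intro rho_bar_in_unit) auto
  have unit: "\<rho>m s \<in> {0..1}" "\<rho>p s \<in> {0..1}" if "0 \<le> s" for s
    using assms(1,3) that by (auto simp: less_imp_le)
  obtain Lm Lp where "Lm-lipschitz_on {0..} \<rho>m" "Lp-lipschitz_on {0..} \<rho>p"
    using assms(2,4) by blast
  define L where "L = max Lm Lp"
  have lip: "L-lipschitz_on {0..} \<rho>m" "L-lipschitz_on {0..} \<rho>p"
    using \<open>Lm-lipschitz_on {0..} \<rho>m\<close> \<open>Lp-lipschitz_on {0..} \<rho>p\<close>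
    by (auto simp: L_def intro: lipschitz_on_le)
  have L0: "0 \<le> L" using lip(1) by (rule lipschitz_on_nonneg)
  obtain K where K: "transition_family (configs N) (K N)"
      "has_generator (configs N) (K N) (L_full \<alpha> \<rho>m \<rho>p N)"
      "markov_process (M N) (configs N) (K N) (\<eta>0 N) (\<eta> N)" for N
    using assms(7) unfolding markov_process_with_generator_def by metis
  obtain c where c: "\<phi> \<xi> = (\<Sum>C\<in>Pow A. c C * occupied C \<xi>)" for \<xi>
    using multilinear_expansion[OF assms(10,11)] by blast
  define u where "u N B = measure_pmf.expectation (K N 0 t (\<eta>0 N)) (occupied B)" for N B
  define T where "T C N = (\<lambda>x. x + \<lfloor>real N * r\<rfloor>) ` C" for C N
  have u_lim: "(\<lambda>N. u N (T C N)) \<longlonglongrightarrow> ?\<rho> ^ card C" if "C \<subseteq> A" for C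
  proof -
    have card: "card (T C N) = card C" for N unfolding T_def by (intro card_image) (auto simp: inj_on_def)
    let ?v = "\<lambda>N. \<Prod>x\<in>T C N. profile N (\<rho>m t) (\<rho>p t) x"
    have "?v N = (\<Prod>x\<in>C. profile N (\<rho>m t) (\<rho>p t) (x + \<lfloor>real N * r\<rfloor>))" for N
      unfolding T_def by (subst prod.reindex) (auto simp: inj_on_def)
    then have v: "?v \<longlonglongrightarrow> ?\<rho> ^ card C"
      using tendsto_prod[of C "\<lambda>x N. profile N (\<rho>m t) (\<rho>p t) (x + \<lfloor>real N * r\<rfloor>)" "\<lambda>_. ?\<rho>" sequentially]
        profile_tendsto_rho_bar by simp
    have "\<forall>\<^sub>F N in sequentially. norm (u N (T C N) - ?v N) \<le>
       3 * card C * exp (- (real N powr \<alpha> * t / 3)) + 3 * card C * (L + 1) * real N powr (- \<alpha>)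
     + (real (card C))\<^sup>2 * ((2 * real N + 1) / (real N)\<^sup>2)"
      using wd eventually_gt_at_top[of 0]
    proof eventually_elim
      case (elim N)
      \<comment> \<open>Well-definedness of the shift enters here, keeping the translated set inside
        the box.\<close>
      have sub: "T C N \<subseteq> sites N" using elim(1) that by (auto simp: T_def shift_well_defined_def)
      have "\<bar>u N (T C N) - ?v N\<bar> \<le> barrier N \<alpha> L (T C N) t"
        unfolding u_def using elim(2) assms(8) K assms(6) unit lip sub
        by (intro correlation_estimate) auto
      also note barrier_le[OF sub elim(2) L0]
      finally show ?case by (simp add: card)
    qed
    then have "(\<lambda>N. u N (T C N) - ?v N) \<longlonglongrightarrow> 0"
      by (rule Lim_null_comparison) (rule barrier_bound_tendsto_zero[OF assms(5,8)])
    from tendsto_add[OF this v] show ?thesis by simp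
  qed
  have shift: "shift m \<phi> \<xi> = (\<Sum>C\<in>Pow A. c C * occupied ((\<lambda>x. x + m) ` C) \<xi>)" for m \<xi>
  proof -
    have "occupied ((\<lambda>x. x + m) ` C) \<xi> = occupied C (\<lambda>z. \<xi> (z + m))" for C
      unfolding occupied_def by (subst prod.reindex) (auto simp: inj_on_def)
    then show ?thesis by (simp add: shift_def c)
  qed
  have "prob_space.expectation (M N) (\<lambda>w. shift \<lfloor>real N * r\<rfloor> \<phi> (\<eta> N t w)) =
     (\<Sum>C\<in>Pow A. c C * u N (T C N))" for N
  proof -
    have "set_pmf (K N 0 t (\<eta>0 N)) \<subseteq> configs N"
      using K(1)[of N] assms(6)[of N] assms(8) unfolding transition_family_def by auto
    then have int: "integrable (K N 0 t (\<eta>0 N)) f" for f :: "_ \<Rightarrow> real"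
      using finite_configs finite_subset by (intro integrable_measure_pmf_finite) blast
    have "prob_space.expectation (M N) (\<lambda>w. shift \<lfloor>real N * r\<rfloor> \<phi> (\<eta> N t w)) =
       measure_pmf.expectation (K N 0 t (\<eta>0 N)) (shift \<lfloor>real N * r\<rfloor> \<phi>)"
      using K(3) finite_configs assms(8) by (intro markov_process_expectation) auto
    then show ?thesis
      unfolding shift u_def T_def using int by simp
  qed
  moreover have "(\<lambda>N. \<Sum>C\<in>Pow A. c C * u N (T C N)) \<longlonglongrightarrow> (\<Sum>C\<in>Pow A. c C * ?\<rho> ^ card C)"
    using u_lim by (intro tendsto_intros) auto
  moreover have "bernoulli_expectation ?\<rho> \<phi> = (\<Sum>C\<in>Pow A. c C * ?\<rho> ^ card C)"
  proof -
    have fin: "finite C" if "C \<in> Pow A" for C using that assms(10) finite_subset by auto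
    have "\<phi> = (\<lambda>\<xi>. \<Sum>C\<in>Pow A. c C * occupied C \<xi>)" using c by blast
    then have "bernoulli_expectation ?\<rho> \<phi> = (\<Sum>C\<in>Pow A. c C * bernoulli_expectation ?\<rho> (occupied C))"
      unfolding bernoulli_expectation_def
      using bernoulli_occupied(1)[OF \<rho> fin] by (simp add: Bochner_Integration.integral_sum)
    then show ?thesis using bernoulli_occupied(2)[OF \<rho> fin] by simp
  qed
  ultimately show "(\<lambda>N. prob_space.expectation (M N) (\<lambda>w. shift \<lfloor>real N * r\<rfloor> \<phi> (\<eta> N t w)))
              \<longlonglongrightarrow> bernoulli_expectation ?\<rho> \<phi>"
    by simp
qed

end
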